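(* Let $\alpha$ be an irrational number with simple continued fraction expansion $\alpha=[b_0;b_1,b_2,\ldots]$, and let $F_n$ be the $n$-th Fibonacci number. Then $$\limsup_{n\to\infty}\frac{\ln b_{n+1}}{\ln(F_n b_1b_2\cdots b_n)}\le\mu(\alpha)-2\le\limsup_{n\to\infty}\frac{\ln b_{n+1}}{\ln(F_n+b_1b_2\cdots b_n)},$$ $$\limsup_{n\to\infty}\frac{\ln b_{n+1}}{F_n b_1b_2\cdots b_n}\le\ln\beta(\alpha)\le\limsup_{n\to\infty}\frac{\ln b_{n+1}}{F_n+b_1b_2\cdots b_n}.$$
   Context: Irrationality exponent: for a real irrational number $\alpha$, $\mu(\alpha)$ is the least real $\mu>0$ such that for every $\varepsilon>0$ there is a positive integer $q(\varepsilon)$ with $\left|\alpha-\frac pq\right|>q^{-(\mu+\varepsilon)}$ for all integers $p,q$ with $q\ge q(\varepsilon)$; if no such $\mu$ exists, $\mu(\alpha)=\infty$. Irrationality base: $\beta(\alpha)$ is the least real $\beta\ge 1$ such that for every $\varepsilon>0$ there is a positive integer $q(\varepsilon)$ with $\left|\alpha-\frac pq\right|>\frac{1}{(\beta+\varepsilon)^q}$ for all integers $p,q$ with $q\ge q(\varepsilon)$; if no such $\beta$ exists, $\beta(\alpha)=\infty$. Conventions: $b_0$ is an integer, $b_1,b_2,\ldots$ are positive integers, and $[b_0;b_1,b_2,\ldots]=b_0+\cfrac{1}{b_1+\cfrac{1}{b_2+\cdots}}$. The Fibonacci numbers are indexed by $F_1=1$, $F_2=2$, $F_{n+1}=F_n+F_{n-1}$.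 The inequalities hold in the extended reals, with $\ln\infty=\infty$. *)

theory Defs
  imports "HOL-Analysis.Analysis" "HOL-Number_Theory.Fib"
begin

definition exponent_bound :: "real \<Rightarrow> real \<Rightarrow> bool" where
  "exponent_bound \<alpha> \<mu> \<longleftrightarrow> \<mu> > 0 \<and>
     (\<forall>\<epsilon>>0. \<exists>Q::nat. Q > 0 \<and>
        (\<forall>(p::int) (q::nat). q \<ge> Q \<longrightarrow>
           \<bar>\<alpha> - of_int p / of_nat q\<bar> > of_nat q powr (-(\<mu> + \<epsilon>))))"

(* The set of bounds is closed under decreasing limits and, if nonempty, has a positive
   infimum, so LEAST is a genuine minimum. *)
definition irrationality_exponent :: "real \<Rightarrow> ereal" where
  "irrationality_exponent \<alpha> =
     (if \<exists>\<mu>. exponent_bound \<alpha> \<mu> then ereal (LEAST \<mu>. exponent_bound \<alpha> \<mu>) else \<infinity>)"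

definition base_bound :: "real \<Rightarrow> real \<Rightarrow> bool" where
  "base_bound \<alpha> \<beta> \<longleftrightarrow> \<beta> \<ge> 1 \<and>
     (\<forall>\<epsilon>>0. \<exists>Q::nat. Q > 0 \<and>
        (\<forall>(p::int) (q::nat). q \<ge> Q \<longrightarrow>
           \<bar>\<alpha> - of_int p / of_nat q\<bar> > 1 / (\<beta> + \<epsilon>) ^ q))"

(* As above, LEAST is a genuine minimum whenever a bound exists. *)
definition irrationality_base :: "real \<Rightarrow> ereal" where
  "irrationality_base \<alpha> =
     (if \<exists>\<beta>. base_bound \<alpha> \<beta> then ereal (LEAST \<beta>. base_bound \<alpha> \<beta>) else \<infinity>)"

(* Only used on [1,\<infinity>], where it is the natural logarithm with ln \<infinity> = \<infinity>. *)
definition ln_ereal :: "ereal \<Rightarrow> ereal" where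
  "ln_ereal x = (if x = \<infinity> then \<infinity> else ereal (ln (real_of_ereal x)))"

(* finite_cfrac b n = [b 0; b 1, ..., b n] *)
fun finite_cfrac :: "(nat \<Rightarrow> int) \<Rightarrow> nat \<Rightarrow> real" where
  "finite_cfrac b 0 = of_int (b 0)"
| "finite_cfrac b (Suc n) = of_int (b 0) + 1 / finite_cfrac (\<lambda>k. b (Suc k)) n"

definition simple_cfrac_expansion :: "real \<Rightarrow> (nat \<Rightarrow> int) \<Rightarrow> bool" where
  "simple_cfrac_expansion \<alpha> b \<longleftrightarrow> (\<forall>k\<ge>1. b k > 0) \<and> finite_cfrac b \<longlonglongrightarrow> \<alpha>"

(* The library has fib 1 = fib 2 = 1; here fibF 1 = 1 and fibF 2 = 2. *)
definition fibF :: "nat \<Rightarrow> nat" where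
  "fibF n = fib (n + 1)"

end

theory Submission
  imports Defs "HOL-Real_Asymp.Real_Asymp"
begin

text \<open>
  With \<open>Q n\<close> the denominator of the \<open>n\<close>-th convergent, \<open>\<alpha>\<close> has distance at most
  \<open>1 / (Q n * Q (n + 1))\<close> to that convergent, and every fraction of denominator \<open>m < Q (n + 1)\<close>
  has distance at least \<open>(1 / m - 1 / Q (n + 1)) / Q (n + 1)\<close> to \<open>\<alpha>\<close>, because it differs from
  the convergent of index \<open>n + 1\<close> by at least \<open>1 / (m * Q (n + 1))\<close>.
  As \<open>Q (n + 1)\<close> lies between \<open>b (n + 1) * Q n\<close> and twice that number, the exponent and the base
  are governed by \<open>ln (b (n + 1)) / ln (Q n)\<close> and \<open>ln (b (n + 1)) / Q n\<close>.
  Finally \<open>F n + B n - 1 \<le> Q n \<le> F n * B n\<close> with \<open>B n = b 1 * \<dots> * b n\<close>, and the term \<open>-1\<close>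
  does not affect the upper limits.
\<close>

section \<open>Attained minima of sets of real bounds\<close>

text \<open>\<open>LEAST\<close> on the reals is informative only if the minimum is attained. The
  infimum exists because of \<open>lower\<close>, and \<open>closed\<close> puts it into the
  set.\<close>

lemma Least_real_attained:
  fixes P :: "real \<Rightarrow> bool"
  assumes "P x0" and lower: "\<And>x. P x \<Longrightarrow> c \<le> x"
    and closed: "\<And>m. c \<le> m \<Longrightarrow> (\<And>e. e > 0 \<Longrightarrow> \<exists>x<m + e. P x) \<Longrightarrow> P m"
  shows "P (LEAST x. P x)" and "P y \<Longrightarrow> (LEAST x. P x) \<le> y"
proof -
  define m where "m = Inf {x. P x}"
  have bdd: "bdd_below {x. P x}"
    by (rule bdd_belowI[of _ c]) (use lower in auto)
  have ne: "{x. P x} \<noteq> {}"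
    using \<open>P x0\<close> by auto
  have least: "m \<le> x" if "P x" for x
    unfolding m_def using that bdd by (auto intro: cInf_lower)
  have "P m"
  proof (rule closed)
    show "c \<le> m"
      unfolding m_def using ne lower by (auto intro: cInf_greatest)
    show "\<exists>x<m + e. P x" if "e > 0" for e
      using cInf_less_iff[OF ne bdd, of "m + e"] that unfolding m_def by auto
  qed
  then have "(LEAST x. P x) = m"
    using least by (rule Least_equality)
  then show "P (LEAST x. P x)" "P y \<Longrightarrow> (LEAST x. P x) \<le> y"
    using \<open>P m\<close> least by auto
qed

text \<open>The slack \<epsilon> is split in halves: one pays for the distance from \<open>m\<close>
  to a nearby bound \<open>x\<close>, the other is the slack used with \<open>x\<close>.\<close>

lemma exponent_bound_closed:
  assumes "m > 0" and approx: "\<And>e. e > 0 \<Longrightarrow> \<exists>x<m + e. exponent_bound \<alpha> x"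
  shows "exponent_bound \<alpha> m"
  unfolding exponent_bound_def
proof (intro conjI allI impI)
  fix \<epsilon> :: real assume "\<epsilon> > 0"
  then obtain x where x: "x < m + \<epsilon> / 2" "exponent_bound \<alpha> x"
    using approx[of "\<epsilon> / 2"] by auto
  then obtain Q :: nat where Q: "Q > 0"
    "\<And>(p::int) q. q \<ge> Q \<Longrightarrow> \<bar>\<alpha> - of_int p / of_nat q\<bar> > of_nat q powr (-(x + \<epsilon> / 2))"
    using \<open>\<epsilon> > 0\<close> unfolding exponent_bound_def by (metis half_gt_zero)
  have "\<bar>\<alpha> - of_int p / of_nat q\<bar> > of_nat q powr (-(m + \<epsilon>))" if "q \<ge> Q" for p :: int and q
  proof -
    have "real q powr (-(m + \<epsilon>)) \<le> real q powr (-(x + \<epsilon> / 2))"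
      using x(1) that \<open>Q > 0\<close> by (intro powr_mono) auto
    then show ?thesis
      using Q(2)[OF that, of p] by linarith
  qed
  then show "\<exists>Q>0. \<forall>(p::int) q. q \<ge> Q \<longrightarrow>
      \<bar>\<alpha> - of_int p / of_nat q\<bar> > of_nat q powr (-(m + \<epsilon>))"
    using \<open>Q > 0\<close> by blast
qed (fact \<open>m > 0\<close>)

lemma base_bound_closed:
  assumes "m \<ge> 1" and approx: "\<And>e. e > 0 \<Longrightarrow> \<exists>x<m + e. base_bound \<alpha> x"
  shows "base_bound \<alpha> m"
  unfolding base_bound_def
proof (intro conjI allI impI)
  fix \<epsilon> :: real assume "\<epsilon> > 0"
  then obtain x where x: "x < m + \<epsilon> / 2" "base_bound \<alpha> x"
    using approx[of "\<epsilon> / 2"] by auto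
  then obtain Q :: nat where Q: "Q > 0"
    "\<And>(p::int) q. q \<ge> Q \<Longrightarrow> \<bar>\<alpha> - of_int p / of_nat q\<bar> > 1 / (x + \<epsilon> / 2) ^ q"
    using \<open>\<epsilon> > 0\<close> unfolding base_bound_def by (metis half_gt_zero)
  have "x \<ge> 1"
    using x(2) unfolding base_bound_def by simp
  have "\<bar>\<alpha> - of_int p / of_nat q\<bar> > 1 / (m + \<epsilon>) ^ q" if "q \<ge> Q" for p :: int and q
  proof -
    have "1 / (m + \<epsilon>) ^ q \<le> 1 / (x + \<epsilon> / 2) ^ q"
      using x(1) \<open>x \<ge> 1\<close> \<open>\<epsilon> > 0\<close> by (intro divide_left_mono power_mono mult_pos_pos zero_less_power) auto
    then show ?thesis
      using Q(2)[OF that, of p] by linarith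
  qed
  then show "\<exists>Q>0. \<forall>(p::int) q. q \<ge> Q \<longrightarrow> \<bar>\<alpha> - of_int p / of_nat q\<bar> > 1 / (m + \<epsilon>) ^ q"
    using \<open>Q > 0\<close> by blast
qed (fact \<open>m \<ge> 1\<close>)

section \<open>Numerators and denominators of convergents\<close>

text \<open>Starting the recurrence at indices 0 and 1, in place of the customary -1 and 0, keeps
  the index a natural number.\<close>

fun conv_num :: "(nat \<Rightarrow> int) \<Rightarrow> nat \<Rightarrow> int" where
  "conv_num b 0 = b 0"
| "conv_num b (Suc 0) = b 1 * b 0 + 1"
| "conv_num b (Suc (Suc n)) = b (Suc (Suc n)) * conv_num b (Suc n) + conv_num b n"

fun conv_den :: "(nat \<Rightarrow> int) \<Rightarrow> nat \<Rightarrow> int" where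
  "conv_den b 0 = 1"
| "conv_den b (Suc 0) = b 1"
| "conv_den b (Suc (Suc n)) = b (Suc (Suc n)) * conv_den b (Suc n) + conv_den b n"

text \<open>\<open>finite_cfrac\<close> splits off the first partial quotient, while the recurrences
  append the last one. This shift and the next one reconcile the two directions.\<close>

lemma conv_den_Suc_shift: "conv_den b (Suc n) = conv_num (\<lambda>k. b (Suc k)) n"
  by (induction b n rule: conv_num.induct) auto

lemma conv_num_Suc_shift:
  "conv_num b (Suc n) = b 0 * conv_num (\<lambda>k. b (Suc k)) n + conv_den (\<lambda>k. b (Suc k)) n"
  by (induction b n rule: conv_num.induct) (auto simp: algebra_simps)

text \<open>Each step of the recurrence flips the sign of the determinant. The identity yields the
  gap between neighbouring convergents and the coprimality of numerator and denominator.\<close>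

lemma conv_det: "conv_num b (Suc n) * conv_den b n - conv_num b n * conv_den b (Suc n) = (-1) ^ n"
  by (induction n) (auto simp: algebra_simps)

lemma conv_den_pos:
  assumes "\<forall>k\<ge>1. b k > 0"
  shows "conv_den b n > 0"
  using assms by (induction b n rule: conv_den.induct) (auto intro!: add_pos_pos mult_pos_pos)

lemma finite_cfrac_eq:
  assumes "\<forall>k\<ge>1. b k > 0"
  shows "finite_cfrac b n = of_int (conv_num b n) / of_int (conv_den b n)"
  using assms
proof (induction n arbitrary: b)
  case (Suc n)
  let ?b = "\<lambda>k. b (Suc k)"
  \<comment> \<open>The fraction for the shifted sequence gets inverted, so its numerator must not
    vanish; that numerator is a denominator of \<open>b\<close>, hence positive.\<close>
  have "conv_den ?b n > 0" "conv_num ?b n > 0"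
    using conv_den_pos[of ?b n] conv_den_pos[of b "Suc n"] Suc.prems
    by (auto simp: conv_den_Suc_shift)
  moreover have "finite_cfrac ?b n = of_int (conv_num ?b n) / of_int (conv_den ?b n)"
    using Suc by auto
  ultimately show ?case
    by (simp add: conv_den_Suc_shift conv_num_Suc_shift add_divide_distrib)
qed simp

lemma le_fib_Suc: "n \<le> fib (Suc n)"
proof (induction n rule: fib.induct)
  case (3 n)
  then show ?case
    using fib_neq_0_nat[of "Suc n"] by (simp del: fib_neq_0_nat)
qed auto

section \<open>Size of the denominators\<close>

locale cfrac_expansion =
  fixes \<alpha> :: real and b :: "nat \<Rightarrow> int"
  assumes expansion: "simple_cfrac_expansion \<alpha> b"
begin

abbreviation "P \<equiv> conv_num b"
abbreviation "Q \<equiv> conv_den b"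

definition B :: "nat \<Rightarrow> real" where
  "B n = (\<Prod>k=1..n. of_int (b k))"

lemma b_pos: "k \<ge> 1 \<Longrightarrow> b k > 0"
  using expansion by (auto simp: simple_cfrac_expansion_def)

lemma Q_pos: "Q n > 0"
  using b_pos by (auto intro: conv_den_pos)

lemma Q_ge_1: "real_of_int (Q n) \<ge> 1"
  using Q_pos[of n] by linarith

lemma b_ge_1: "real_of_int (b (Suc n)) \<ge> 1"
  using b_pos[of "Suc n"] by linarith

text \<open>The summand added by the recurrence is an earlier denominator, hence at most the main
  term. Monotonicity enters this argument, so all three claims share one induction.\<close>

lemma Q_Suc_bounds: "b (Suc n) * Q n \<le> Q (Suc n)" "Q (Suc n) \<le> 2 * (b (Suc n) * Q n)"
  and Q_le_Suc: "Q n \<le> Q (Suc n)"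
proof -
  have *: "b (Suc n) * Q n \<le> Q (Suc n) \<and> Q (Suc n) \<le> 2 * (b (Suc n) * Q n) \<and> Q n \<le> Q (Suc n)"
  proof (induction n)
    case 0
    show ?case using b_pos[of 1] by auto
  next
    case (Suc n)
    have "Q n \<le> Q (Suc n)" using Suc by simp
    moreover have "Q (Suc n) \<le> b (Suc (Suc n)) * Q (Suc n)"
      using b_pos[of "Suc (Suc n)"] Q_pos[of "Suc n"] by (simp add: mult_le_cancel_right1)
    moreover have "Q (Suc (Suc n)) = b (Suc (Suc n)) * Q (Suc n) + Q n"
      by simp
    ultimately show ?case
      using Q_pos[of n] by linarith
  qed
  then show "b (Suc n) * Q n \<le> Q (Suc n)" "Q (Suc n) \<le> 2 * (b (Suc n) * Q n)" "Q n \<le> Q (Suc n)"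
    by auto
qed

lemma Q_mono: "mono Q"
  using Q_le_Suc by (auto intro: incseq_SucI)

lemma B_Suc: "B (Suc n) = B n * of_int (b (Suc n))"
  by (simp add: B_def)

lemma B_ge_1: "B n \<ge> 1"
  unfolding B_def using b_pos by (intro prod_ge_1) force

text \<open>Bounding \<open>B n\<close> by \<open>B (Suc (Suc n))\<close> lets both summands of the
  recurrence share this factor; what remains is the Fibonacci recurrence.\<close>

lemma Q_le_mult: "of_int (Q n) \<le> of_nat (fibF n) * B n"
proof (induction n rule: fib.induct)
  case (3 n)
  have "real_of_int (b (Suc (Suc n))) * of_int (Q (Suc n))
      \<le> of_int (b (Suc (Suc n))) * (of_nat (fibF (Suc n)) * B (Suc n))"
    using 3 b_ge_1[of "Suc n"] by (intro mult_left_mono) auto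
  moreover have "of_nat (fibF n) * B n \<le> of_nat (fibF n) * B (Suc (Suc n))"
  proof -
    have "B n * 1 \<le> B n * (of_int (b (Suc n)) * of_int (b (Suc (Suc n))))"
      using B_ge_1[of n] b_ge_1[of n] b_ge_1[of "Suc n"]
      by (intro mult_left_mono) (auto intro!: mult_ge1_I)
    then show ?thesis
      by (intro mult_left_mono) (auto simp: B_Suc mult.assoc)
  qed
  ultimately show ?case
    using 3 by (simp add: fibF_def B_Suc algebra_simps)
qed (auto simp: fibF_def B_def)

text \<open>Equality holds at \<open>n = 0\<close> and \<open>n = 1\<close>, which is where the -1
  comes from.\<close>

lemma Q_ge_add: "of_nat (fibF n) + B n - 1 \<le> of_int (Q n)"
proof (induction n rule: fib.induct)
  case (3 n)
  define c :: real where "c = of_int (b (Suc (Suc n)))"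
  define f :: real where "f = of_nat (fib (Suc (Suc n)))"
  have "c * (f + B (Suc n) - 1) \<le> c * of_int (Q (Suc n))"
    using 3 b_ge_1[of "Suc n"] by (intro mult_left_mono) (auto simp: c_def f_def fibF_def)
  \<comment> \<open>Expanded, this reads \<open>c * f - c \<ge> f - 1\<close>: it turns the product
    from the recurrence into the desired sum. The -1 contributed by the hypothesis for
    \<open>n\<close> is then absorbed by \<open>B n \<ge> 1\<close>.\<close>
  moreover have "(c - 1) * (f - 1) \<ge> 0"
    using b_ge_1[of "Suc n"] fib_neq_0_nat[of "Suc (Suc n)"]
    by (intro mult_nonneg_nonneg) (auto simp: c_def f_def simp del: fib.simps fib_neq_0_nat)
  moreover have "of_nat (fib (Suc n)) + B n - 1 \<le> real_of_int (Q n)"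
    using 3 by (simp add: fibF_def)
  moreover have "of_nat (fibF (Suc (Suc n))) = f + of_nat (fib (Suc n))"
    by (simp add: fibF_def f_def)
  moreover have "B (Suc (Suc n)) = c * B (Suc n)"
    by (simp add: B_Suc c_def)
  moreover have "real_of_int (Q (Suc (Suc n))) = c * of_int (Q (Suc n)) + of_int (Q n)"
    by (simp add: c_def)
  ultimately show ?case
    using B_ge_1[of n] by (simp add: algebra_simps del: conv_den.simps)
qed (auto simp: fibF_def B_def)

text \<open>The Fibonacci part of the lower bound alone makes the denominators unbounded.\<close>

lemma Q_ge: "real n \<le> of_int (Q n)"
  using Q_ge_add[of n] B_ge_1[of n] le_fib_Suc[of n] by (simp add: fibF_def)

lemma Q_ge_int: "int n \<le> Q n"
  using Q_ge[of n] by linarith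

text \<open>The -1 is traded for a factor 2, which is harmless inside a logarithm.\<close>

lemma add_le_2Q: "of_nat (fibF n) + B n \<le> 2 * of_int (Q n)"
  using Q_ge_add[of n] Q_ge_1[of n] by linarith

section \<open>Distance from \<alpha> to convergents and to other fractions\<close>

text \<open>By the recurrence the convergent of index \<open>n + 2\<close> is a weighted mean of the
  two before it; the weight \<open>u\<close> of the nearer one is its share of the denominator
  \<open>Q (n + 2)\<close>.\<close>

lemma segment_decreasing:
  "closed_segment (finite_cfrac b (Suc n)) (finite_cfrac b (Suc (Suc n)))
    \<subseteq> closed_segment (finite_cfrac b n) (finite_cfrac b (Suc n))"
proof -
  define c where "c = real_of_int (b (Suc (Suc n)))"
  define u where "u = c * of_int (Q (Suc n)) / of_int (Q (Suc (Suc n)))"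
  have Q: "real_of_int (Q n) > 0" "real_of_int (Q (Suc n)) > 0"
    using Q_pos by auto
  have c: "c \<ge> 1"
    unfolding c_def by (rule b_ge_1)
  have QQ: "real_of_int (Q (Suc (Suc n))) = c * of_int (Q (Suc n)) + of_int (Q n)"
    by (simp add: c_def)
  have PP: "real_of_int (P (Suc (Suc n))) = c * of_int (P (Suc n)) + of_int (P n)"
    by (simp add: c_def)
  have pos: "c * of_int (Q (Suc n)) + of_int (Q n) > 0"
    using Q c by (intro add_pos_pos mult_pos_pos) auto
  have u: "0 \<le> u" "u \<le> 1"
    unfolding u_def QQ using Q c pos by auto
  have u': "1 - u = of_int (Q n) / (c * of_int (Q (Suc n)) + of_int (Q n))"
    unfolding u_def QQ using pos by (simp add: field_simps)
  have "finite_cfrac b (Suc (Suc n)) = (1 - u) * finite_cfrac b n + u * finite_cfrac b (Suc n)"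
  proof -
    have "(1 - u) * finite_cfrac b n = of_int (P n) / (c * of_int (Q (Suc n)) + of_int (Q n))"
      unfolding u' using Q b_pos by (subst finite_cfrac_eq) auto
    moreover have "u * finite_cfrac b (Suc n)
        = c * of_int (P (Suc n)) / (c * of_int (Q (Suc n)) + of_int (Q n))"
      unfolding u_def QQ using Q b_pos by (subst finite_cfrac_eq) auto
    moreover have "finite_cfrac b (Suc (Suc n))
        = (c * of_int (P (Suc n)) + of_int (P n)) / (c * of_int (Q (Suc n)) + of_int (Q n))"
      using b_pos by (subst finite_cfrac_eq) (auto simp only: PP QQ)
    ultimately show ?thesis
      by (simp add: add_divide_distrib)
  qed
  then have "finite_cfrac b (Suc (Suc n))
      \<in> closed_segment (finite_cfrac b n) (finite_cfrac b (Suc n))"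
    using u by (auto simp: closed_segment_def)
  then show ?thesis
    by (simp add: subset_closed_segment)
qed

text \<open>The segments are nested and closed, so each contains all later convergents and therefore
  their limit.\<close>

lemma limit_in_segment: "\<alpha> \<in> closed_segment (finite_cfrac b n) (finite_cfrac b (Suc n))"
proof -
  define S where "S n = closed_segment (finite_cfrac b n) (finite_cfrac b (Suc n))" for n
  have decreasing: "S (Suc n) \<subseteq> S n" for n
    unfolding S_def by (rule segment_decreasing)
  have "S m \<subseteq> S n" if "m \<ge> n" for m
    using decreasing that by (rule lift_Suc_antimono_le)
  moreover have "finite_cfrac b m \<in> S m" for m
    by (simp add: S_def)
  ultimately have "\<forall>\<^sub>F m in sequentially. finite_cfrac b m \<in> S n"
    unfolding eventually_sequentially by blast
  moreover have "finite_cfrac b \<longlonglongrightarrow> \<alpha>"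
    using expansion by (simp add: simple_cfrac_expansion_def)
  moreover have "closed (S n)"
    by (simp add: S_def)
  ultimately have "\<alpha> \<in> S n"
    by (intro Lim_in_closed_set) auto
  then show ?thesis
    by (simp add: S_def)
qed

lemma convergent_upper:
  "\<bar>\<alpha> - of_int (P n) / of_int (Q n)\<bar> \<le> 1 / (of_int (Q n) * of_int (Q (Suc n)))"
proof -
  have Q: "real_of_int (Q n) > 0" "real_of_int (Q (Suc n)) > 0"
    using Q_pos by auto
  have b_all: "\<forall>k\<ge>1. b k > 0"
    using b_pos by simp
  \<comment> \<open>The distance from an endpoint is at most the length of the segment, which the
    determinant identity computes.\<close>
  have "\<bar>\<alpha> - finite_cfrac b n\<bar> \<le> \<bar>finite_cfrac b (Suc n) - finite_cfrac b n\<bar>"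
    using segment_bound1[OF limit_in_segment[of n]] by simp
  also have "finite_cfrac b (Suc n) - finite_cfrac b n
      = of_int (P (Suc n) * Q n - P n * Q (Suc n)) / (of_int (Q n) * of_int (Q (Suc n)))"
    unfolding finite_cfrac_eq[OF b_all]
    using Q by (simp add: diff_frac_eq mult.commute del: conv_num.simps conv_den.simps)
  also have "\<bar>\<dots>\<bar> = 1 / (of_int (Q n) * of_int (Q (Suc n)))"
    unfolding conv_det using Q by (simp add: abs_mult power_abs)
  finally show ?thesis
    using b_pos by (simp add: finite_cfrac_eq)
qed

lemma fraction_lower:
  fixes p m :: int
  assumes "m > 0" "m < Q (Suc n)"
  shows "\<bar>\<alpha> - of_int p / of_int m\<bar> \<ge> (1 / of_int m - 1 / of_int (Q (Suc n))) / of_int (Q (Suc n))"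
proof -
  let ?q = "Q (Suc n)" and ?p = "P (Suc n)"
  have pos: "real_of_int ?q > 0" "real_of_int m > 0"
    using Q_pos assms by auto
  \<comment> \<open>Equality of the fractions would make \<open>?q\<close> divide \<open>m\<close>
    by the determinant identity, although \<open>m\<close> is positive and smaller.\<close>
  have "p * ?q \<noteq> ?p * m"
  proof
    assume eq: "p * ?q = ?p * m"
    have "m * (-1) ^ n = m * (?p * Q n) - m * (P n * ?q)"
      by (simp only: conv_det[of b n, symmetric] right_diff_distrib)
    also have "m * (?p * Q n) = p * ?q * Q n"
      by (simp add: eq)
    finally have "?q dvd m * (-1) ^ n"
      by simp
    then have "?q dvd m"
      by (cases "even n") auto
    then show False
      using assms zdvd_imp_le by fastforce
  qed
  then have "1 \<le> \<bar>p * ?q - ?p * m\<bar>"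
    by linarith
  then have "1 \<le> \<bar>real_of_int p * of_int ?q - of_int ?p * of_int m\<bar>"
    by (metis of_int_1_le_iff of_int_abs of_int_diff of_int_mult)
  then have "1 / (of_int m * of_int ?q)
      \<le> \<bar>real_of_int p * of_int ?q - of_int ?p * of_int m\<bar> / (of_int m * of_int ?q)"
    using pos by (intro divide_right_mono) auto
  also have "\<dots> = \<bar>of_int p / of_int m - of_int ?p / of_int ?q\<bar>"
    using pos by (simp add: diff_frac_eq abs_divide abs_mult)
  finally have "1 / (of_int m * of_int ?q) \<le> \<bar>real_of_int p / of_int m - of_int ?p / of_int ?q\<bar>" .
  moreover have "\<bar>\<alpha> - of_int ?p / of_int ?q\<bar> \<le> 1 / (of_int ?q * of_int ?q)"
  proof -
    have "1 / (real_of_int ?q * of_int (Q (Suc (Suc n)))) \<le> 1 / (of_int ?q * of_int ?q)"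
      using Q_pos[of "Suc (Suc n)"] pos Q_le_Suc[of "Suc n"]
      by (intro divide_left_mono mult_left_mono mult_pos_pos) (auto simp del: conv_den.simps)
    then show ?thesis
      using convergent_upper[of "Suc n"] by linarith
  qed
  ultimately show ?thesis
    by (simp add: diff_divide_distrib del: conv_den.simps conv_num.simps)
qed

text \<open>As \<open>Q 0 = 1\<close> and \<open>Q\<close> is unbounded, the least \<open>n\<close>
  with \<open>m < Q (Suc n)\<close> works. It selects the convergent against which a fraction of
  given denominator is compared.\<close>

lemma between_denominators:
  fixes m :: int
  assumes "m > 0"
  obtains n where "Q n \<le> m" "m < Q (Suc n)"
proof -
  have "m < Q (Suc (nat m))"
    using Q_ge_int[of "Suc (nat m)"] assms by linarith
  then have ex: "\<exists>n. m < Q (Suc n)" by blast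
  define n where "n = (LEAST n. m < Q (Suc n))"
  have "m < Q (Suc n)"
    unfolding n_def using ex by (rule LeastI_ex)
  moreover have "Q n \<le> m"
  proof (cases n)
    case 0
    then show ?thesis using assms by simp
  next
    case (Suc k)
    then show ?thesis
      using not_less_Least[of k "\<lambda>n. m < Q (Suc n)"] unfolding n_def by simp
  qed
  ultimately show ?thesis
    using that by blast
qed

lemma eventually_Q_ge: "\<forall>\<^sub>F n in sequentially. Q n \<ge> m"
  using eventually_ge_at_top[of "nat m"]
proof eventually_elim
  case (elim n)
  then show ?case using Q_ge_int[of n] by linarith
qed

lemma nat_Q: "real (nat (Q n)) = of_int (Q n)"
  using Q_pos[of n] by simp

section \<open>Lower estimates: testing the bounds at convergents\<close>

text \<open>The bound is applied to the convergent of index \<open>n\<close>, whose distance to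
  \<alpha> is at most \<open>1 / (q * (c * q))\<close>; taking logarithms gives the claim.\<close>

lemma exponent_bound_imp_growth:
  assumes "exponent_bound \<alpha> \<mu>" "\<epsilon> > 0"
  shows "\<forall>\<^sub>F n in sequentially. ln (of_int (b (Suc n))) \<le> (\<mu> + \<epsilon> - 2) * ln (of_int (Q n))"
proof -
  obtain N :: nat where N: "\<And>(p::int) q. q \<ge> N \<Longrightarrow>
      \<bar>\<alpha> - of_int p / of_nat q\<bar> > of_nat q powr (-(\<mu> + \<epsilon>))"
    using assms unfolding exponent_bound_def by blast
  show ?thesis
    using eventually_Q_ge[of "int N"]
  proof eventually_elim
    case (elim n)
    define q where "q = real_of_int (Q n)"
    define c where "c = real_of_int (b (Suc n))"
    have q: "q \<ge> 1" and c: "c \<ge> 1"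
      using Q_ge_1 b_ge_1 by (auto simp: q_def c_def)
    have "q powr (-(\<mu> + \<epsilon>)) < \<bar>\<alpha> - of_int (P n) / q\<bar>"
      using N[of "nat (Q n)" "P n"] elim by (simp add: nat_Q q_def)
    also have "\<dots> \<le> 1 / (q * of_int (Q (Suc n)))"
      unfolding q_def by (rule convergent_upper)
    also have "\<dots> \<le> 1 / (q * (c * q))"
      using q c Q_pos[of "Suc n"] Q_Suc_bounds(1)[of n]
      by (intro divide_left_mono mult_left_mono mult_pos_pos)
        (auto simp: q_def c_def simp flip: of_int_mult simp del: conv_den.simps)
    finally have "ln (q powr (-(\<mu> + \<epsilon>))) \<le> ln (1 / (q * (c * q)))"
      using q c by (intro ln_mono) auto
    also have "\<dots> = - (ln c + 2 * ln q)"
      using q c by (simp add: ln_div ln_mult)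
    finally show ?case
      using q by (simp add: ln_powr q_def c_def algebra_simps)
  qed
qed

text \<open>Since \<open>ln (b (Suc n))\<close> is nonnegative, the growth estimate at an index with
  \<open>ln (Q n) > 0\<close> forces a nonnegative coefficient.\<close>

lemma exponent_bound_ge_2:
  assumes "exponent_bound \<alpha> \<mu>"
  shows "\<mu> \<ge> 2"
proof (rule field_le_epsilon)
  fix \<epsilon> :: real assume "\<epsilon> > 0"
  then have "\<forall>\<^sub>F n in sequentially.
      ln (of_int (b (Suc n))) \<le> (\<mu> + \<epsilon> - 2) * ln (of_int (Q n)) \<and> Q n \<ge> 2"
    using exponent_bound_imp_growth[OF assms] eventually_Q_ge by (intro eventually_conj)
  then obtain n where n: "ln (of_int (b (Suc n))) \<le> (\<mu> + \<epsilon> - 2) * ln (of_int (Q n))" "Q n \<ge> 2"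
    using eventually_happens'[OF sequentially_bot] by blast
  have "ln (real_of_int (b (Suc n))) \<ge> 0"
    using b_ge_1 by simp
  then have "0 \<le> (\<mu> + \<epsilon> - 2) * ln (real_of_int (Q n))"
    using n by linarith
  moreover have "ln (real_of_int (Q n)) > 0"
    using n(2) by simp
  ultimately show "2 \<le> \<mu> + \<epsilon>"
    by (simp add: zero_le_mult_iff)
qed

lemma limsup_le_of_exponent_bound:
  assumes "exponent_bound \<alpha> \<mu>"
  shows "limsup (\<lambda>n. ereal (ln (of_int (b (n + 1))) / ln (of_nat (fibF n) * B n))) \<le> ereal (\<mu> - 2)"
proof (rule ereal_le_epsilon2)
  fix \<epsilon> :: real assume "\<epsilon> > 0"
  have "\<forall>\<^sub>F n in sequentially.
      ereal (ln (of_int (b (n + 1))) / ln (of_nat (fibF n) * B n)) \<le> ereal (\<mu> - 2 + \<epsilon>)"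
    \<comment> \<open>\<open>Q n \<ge> 2\<close> keeps the logarithm in the denominator positive; at
      \<open>n = 0\<close> it is 0.\<close>
    using exponent_bound_imp_growth[OF assms \<open>\<epsilon> > 0\<close>] eventually_Q_ge[of 2]
  proof eventually_elim
    case (elim n)
    have q: "real_of_int (Q n) \<ge> 2"
      using elim by simp
    have "ln (real_of_int (Q n)) \<le> ln (of_nat (fibF n) * B n)"
      using Q_le_mult[of n] q by (intro ln_mono) auto
    moreover have "\<mu> + \<epsilon> - 2 \<ge> 0"
      using exponent_bound_ge_2[OF assms] \<open>\<epsilon> > 0\<close> by simp
    ultimately have "ln (of_int (b (Suc n))) \<le> (\<mu> + \<epsilon> - 2) * ln (of_nat (fibF n) * B n)"
      using elim(1) by (meson mult_left_mono order_trans)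
    moreover have "ln (of_nat (fibF n) * B n) > 0"
      using Q_le_mult[of n] q by (intro ln_gt_zero) auto
    ultimately have "ln (of_int (b (Suc n))) / ln (of_nat (fibF n) * B n) \<le> \<mu> + \<epsilon> - 2"
      by (simp add: divide_le_eq)
    then show ?case
      by simp
  qed
  then have "limsup (\<lambda>n. ereal (ln (of_int (b (n + 1))) / ln (of_nat (fibF n) * B n)))
      \<le> ereal (\<mu> - 2 + \<epsilon>)"
    by (rule Limsup_bounded)
  then show "limsup (\<lambda>n. ereal (ln (of_int (b (n + 1))) / ln (of_nat (fibF n) * B n)))
      \<le> ereal (\<mu> - 2) + ereal \<epsilon>"
    by simp
qed

lemma base_bound_imp_growth:
  assumes "base_bound \<alpha> \<beta>" "\<epsilon> > 0"
  shows "\<forall>\<^sub>F n in sequentially. ln (of_int (b (Suc n))) \<le> of_int (Q n) * ln (\<beta> + \<epsilon>)"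
proof -
  have "\<beta> \<ge> 1"
    using assms unfolding base_bound_def by simp
  obtain N :: nat where N: "\<And>(p::int) q. q \<ge> N \<Longrightarrow>
      \<bar>\<alpha> - of_int p / of_nat q\<bar> > 1 / (\<beta> + \<epsilon>) ^ q"
    using assms unfolding base_bound_def by blast
  show ?thesis
    using eventually_Q_ge[of "int N"]
  proof eventually_elim
    case (elim n)
    define q where "q = real_of_int (Q n)"
    define c where "c = real_of_int (b (Suc n))"
    have q: "q \<ge> 1" and c: "c \<ge> 1"
      using Q_ge_1 b_ge_1 by (auto simp: q_def c_def)
    have "1 / (\<beta> + \<epsilon>) ^ nat (Q n) < \<bar>\<alpha> - of_int (P n) / q\<bar>"
      using N[of "nat (Q n)" "P n"] elim by (simp add: nat_Q q_def)
    also have "\<dots> \<le> 1 / (q * of_int (Q (Suc n)))"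
      unfolding q_def by (rule convergent_upper)
    \<comment> \<open>Factors polynomial in \<open>q\<close> do not matter against an exponential in
      \<open>q\<close>, so they are dropped.\<close>
    also have "\<dots> \<le> 1 / (1 * (c * 1))"
    proof (intro divide_left_mono mult_mono mult_pos_pos)
      have "c * 1 \<le> c * q"
        using q c by (intro mult_left_mono) auto
      also have "\<dots> \<le> of_int (Q (Suc n))"
        using Q_Suc_bounds(1)[of n]
        by (auto simp: q_def c_def simp flip: of_int_mult simp del: conv_den.simps)
      finally show "c * 1 \<le> of_int (Q (Suc n))" .
    qed (use q c Q_pos[of "Suc n"] in auto)
    finally have "c < (\<beta> + \<epsilon>) ^ nat (Q n)"
      using c \<open>\<beta> \<ge> 1\<close> \<open>\<epsilon> > 0\<close> by (simp add: field_simps)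
    then have "ln c \<le> ln ((\<beta> + \<epsilon>) ^ nat (Q n))"
      using c by (intro ln_mono) auto
    also have "\<dots> = q * ln (\<beta> + \<epsilon>)"
      using \<open>\<beta> \<ge> 1\<close> \<open>\<epsilon> > 0\<close> by (simp add: ln_realpow nat_Q q_def)
    finally show ?case
      by (simp add: q_def c_def)
  qed
qed

lemma limsup_le_of_base_bound:
  assumes "base_bound \<alpha> \<beta>"
  shows "limsup (\<lambda>n. ereal (ln (of_int (b (n + 1))) / (of_nat (fibF n) * B n))) \<le> ereal (ln \<beta>)"
proof (rule ereal_le_epsilon2)
  fix \<epsilon> :: real assume "\<epsilon> > 0"
  have "\<beta> \<ge> 1"
    using assms unfolding base_bound_def by simp
  \<comment> \<open>Chosen so that passing from \<beta> to \<beta> + \<delta> raises the logarithm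
    by exactly \<epsilon>.\<close>
  define \<delta> where "\<delta> = \<beta> * exp \<epsilon> - \<beta>"
  have "\<delta> > 0"
    using \<open>\<beta> \<ge> 1\<close> \<open>\<epsilon> > 0\<close> by (simp add: \<delta>_def)
  have ln: "ln (\<beta> + \<delta>) = ln \<beta> + \<epsilon>"
    using \<open>\<beta> \<ge> 1\<close> by (simp add: \<delta>_def ln_mult)
  have "\<forall>\<^sub>F n in sequentially.
      ereal (ln (of_int (b (n + 1))) / (of_nat (fibF n) * B n)) \<le> ereal (ln \<beta> + \<epsilon>)"
    using base_bound_imp_growth[OF assms \<open>\<delta> > 0\<close>]
  proof eventually_elim
    case (elim n)
    have "of_int (Q n) * ln (\<beta> + \<delta>) \<le> (of_nat (fibF n) * B n) * ln (\<beta> + \<delta>)"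
      using Q_le_mult[of n] \<open>\<beta> \<ge> 1\<close> \<open>\<epsilon> > 0\<close> by (intro mult_right_mono) (auto simp: ln)
    moreover have "of_nat (fibF n) * B n > 0"
      using Q_le_mult[of n] Q_ge_1[of n] by linarith
    ultimately show ?case
      using elim by (simp add: divide_le_eq ln mult.commute)
  qed
  then have "limsup (\<lambda>n. ereal (ln (of_int (b (n + 1))) / (of_nat (fibF n) * B n)))
      \<le> ereal (ln \<beta> + \<epsilon>)"
    by (rule Limsup_bounded)
  then show "limsup (\<lambda>n. ereal (ln (of_int (b (n + 1))) / (of_nat (fibF n) * B n)))
      \<le> ereal (ln \<beta>) + ereal \<epsilon>"
    by simp
qed

section \<open>Upper estimates: bounds for all fractions from the growth of \<open>b\<close>\<close>

text \<open>A fraction of denominator \<open>q\<close> is compared with the first convergent whose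
  denominator \<open>d\<close> exceeds \<open>2 * q\<close>. Its distance to \<alpha> is then at
  least \<open>1 / (2 * q * d)\<close>, and the growth hypothesis bounds \<open>d\<close> by a
  constant times \<open>q powr (M + 1)\<close>.\<close>

lemma exponent_bound_of_growth:
  assumes "M \<ge> 0"
    and growth: "\<forall>\<^sub>F n in sequentially. ln (of_int (b (Suc n))) \<le> M * ln (2 * of_int (Q n))"
  shows "exponent_bound \<alpha> (2 + M)"
  unfolding exponent_bound_def
proof (intro conjI allI impI)
  fix \<epsilon> :: real assume "\<epsilon> > 0"
  obtain N where N: "\<And>n. n \<ge> N \<Longrightarrow> ln (of_int (b (Suc n))) \<le> M * ln (2 * of_int (Q n))"
    using growth by (auto simp: eventually_sequentially)
  \<comment> \<open>The 8 collects three factors 2: from \<open>2 * q * d\<close>, from the upper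
    bound on \<open>Q (Suc n)\<close>, and from \<open>Q n \<le> 2 * q\<close>. The power of 4
    bounds \<open>2 * Q n\<close> by \<open>4 * q\<close>.\<close>
  have "\<forall>\<^sub>F q in sequentially. 8 * 4 powr M < real q powr \<epsilon>"
    using \<open>\<epsilon> > 0\<close> by real_asymp
  moreover have "\<forall>\<^sub>F q in sequentially. q \<ge> nat (Q N)"
    by (rule eventually_ge_at_top)
  ultimately have "\<forall>\<^sub>F q in sequentially. 8 * 4 powr M < real q powr \<epsilon> \<and> q \<ge> nat (Q N) \<and> q \<ge> 1"
    using eventually_ge_at_top[of 1] by (intro eventually_conj)
  then obtain R where R: "\<And>q. q \<ge> R \<Longrightarrow> 8 * 4 powr M < real q powr \<epsilon> \<and> q \<ge> nat (Q N) \<and> q \<ge> 1"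
    by (auto simp: eventually_sequentially)
  have "\<bar>\<alpha> - of_int p / of_nat q\<bar> > of_nat q powr (-(2 + M + \<epsilon>))" if "q \<ge> R" for p :: int and q
  proof -
    have q: "8 * 4 powr M < real q powr \<epsilon>" "Q N \<le> int q" "real q \<ge> 1"
      using R[OF that] by auto
    obtain n where n: "Q n \<le> 2 * int q" "2 * int q < Q (Suc n)"
      using between_denominators[of "2 * int q"] q by auto
    have "Q N < Q (Suc n)"
      using q n by linarith
    then have "N \<le> n"
      using monoD[OF Q_mono, of "Suc n" N] by linarith
    define c where "c = real_of_int (b (Suc n))"
    define d where "d = real_of_int (Q (Suc n))"
    have c: "c \<ge> 1"
      unfolding c_def by (rule b_ge_1)
    have "c = exp (ln c)"
      using c by simp
    also have "\<dots> \<le> exp (M * ln (2 * of_int (Q n)))"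
      using N[OF \<open>N \<le> n\<close>] by (simp add: c_def)
    also have "\<dots> = (2 * of_int (Q n)) powr M"
      using Q_pos[of n] by (simp add: powr_def)
    also have "\<dots> \<le> (4 * real q) powr M"
      using n(1) Q_pos[of n] \<open>M \<ge> 0\<close> by (intro powr_mono2) auto
    finally have c_le: "c \<le> 4 powr M * real q powr M"
      using q by (simp add: powr_mult)
    have "d \<le> 2 * (c * of_int (Q n))"
      using Q_Suc_bounds(2)[of n] unfolding c_def d_def by (simp flip: of_int_mult)
    also have "\<dots> \<le> 2 * ((4 powr M * real q powr M) * (2 * real q))"
      using c_le n(1) Q_pos[of n] c by (intro mult_left_mono mult_mono) auto
    finally have "2 * real q * d \<le> 2 * real q * (2 * ((4 powr M * real q powr M) * (2 * real q)))"
      using q by (intro mult_left_mono) auto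
    also have "\<dots> = 8 * 4 powr M * (real q powr M * real q powr 2)"
      using q by (simp add: power2_eq_square)
    also have "\<dots> < real q powr \<epsilon> * (real q powr M * real q powr 2)"
      using q by (intro mult_strict_right_mono) auto
    also have "\<dots> = real q powr (2 + M + \<epsilon>)"
      by (simp add: powr_add)
    finally have less: "2 * real q * d < real q powr (2 + M + \<epsilon>)" .
    have d: "d > 2 * real q"
      using n(2) unfolding d_def by linarith
    have "real q powr (-(2 + M + \<epsilon>)) = 1 / real q powr (2 + M + \<epsilon>)"
      by (rule powr_minus_divide)
    also have "\<dots> < 1 / (2 * real q * d)"
      using less q d by (intro divide_strict_left_mono mult_pos_pos) auto
    also have "\<dots> \<le> (1 / real q - 1 / d) / d"
    proof -
      have "1 / d \<le> 1 / (2 * real q)"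
        using d q by (intro divide_left_mono) auto
      then have "1 / (2 * real q) \<le> 1 / real q - 1 / d"
        using q by (simp add: field_simps)
      then have "1 / (2 * real q) / d \<le> (1 / real q - 1 / d) / d"
        using d q by (intro divide_right_mono) auto
      then show ?thesis
        by simp
    qed
    also have "\<dots> \<le> \<bar>\<alpha> - of_int p / real q\<bar>"
      using fraction_lower[of "int q" n p] n(2) q by (simp add: d_def)
    finally show ?thesis .
  qed
  moreover have "R > 0"
    using R[of R] by auto
  ultimately show "\<exists>Q>0. \<forall>(p::int) q. q \<ge> Q \<longrightarrow>
      \<bar>\<alpha> - of_int p / of_nat q\<bar> > of_nat q powr (-(2 + M + \<epsilon>))"
    by blast
qed (use \<open>M \<ge> 0\<close> in auto)

text \<open>A factor 2 in front of \<open>q\<close> would double the exponent here, so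
  \<open>n\<close> is chosen with \<open>Q n \<le> q < Q (Suc n)\<close>. Only
  \<open>d \<ge> q + 1\<close> is then available for \<open>d = Q (Suc n)\<close>; the resulting
  polynomial loss is absorbed by \<epsilon>.\<close>

lemma base_bound_of_growth:
  assumes "M \<ge> 0"
    and growth: "\<forall>\<^sub>F n in sequentially. ln (of_int (b (Suc n))) \<le> M * (of_int (Q n) + 1)"
  shows "base_bound \<alpha> (exp M)"
  unfolding base_bound_def
proof (intro conjI allI impI)
  fix \<epsilon> :: real assume "\<epsilon> > 0"
  obtain N where N: "\<And>n. n \<ge> N \<Longrightarrow> ln (of_int (b (Suc n))) \<le> M * (of_int (Q n) + 1)"
    using growth by (auto simp: eventually_sequentially)
  define r where "r = (exp M + \<epsilon>) / exp M"
  have "r > 1"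
    using \<open>\<epsilon> > 0\<close> by (simp add: r_def field_simps)
  \<comment> \<open>The 2 comes from the upper bound on \<open>Q (Suc n)\<close>,
    \<open>exp M\<close> from the summand 1 in the growth hypothesis, one \<open>q\<close> from
    \<open>Q n \<le> q\<close>, and \<open>q * (q + 1)\<close> from the gap
    \<open>1 / q - 1 / (q + 1)\<close>.\<close>
  have "\<forall>\<^sub>F q in sequentially. 2 * exp M * (real q ^ 2 * (real q + 1)) < r ^ q"
    using \<open>r > 1\<close> by real_asymp
  then have "\<forall>\<^sub>F q in sequentially. 2 * exp M * (real q ^ 2 * (real q + 1)) < r ^ q
      \<and> q \<ge> nat (Q N) \<and> q \<ge> 1"
    using eventually_ge_at_top[of "nat (Q N)"] eventually_ge_at_top[of 1]
    by (intro eventually_conj)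
  then obtain R where R: "\<And>q. q \<ge> R \<Longrightarrow> 2 * exp M * (real q ^ 2 * (real q + 1)) < r ^ q
      \<and> q \<ge> nat (Q N) \<and> q \<ge> 1"
    by (auto simp: eventually_sequentially)
  have "\<bar>\<alpha> - of_int p / of_nat q\<bar> > 1 / (exp M + \<epsilon>) ^ q" if "q \<ge> R" for p :: int and q
  proof -
    have q: "2 * exp M * (real q ^ 2 * (real q + 1)) < r ^ q" "Q N \<le> int q" "real q \<ge> 1"
      using R[OF that] by auto
    obtain n where n: "Q n \<le> int q" "int q < Q (Suc n)"
      using between_denominators[of "int q"] q by auto
    have "Q N < Q (Suc n)"
      using q n by linarith
    then have "N \<le> n"
      using monoD[OF Q_mono, of "Suc n" N] by linarith
    define c where "c = real_of_int (b (Suc n))"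
    define d where "d = real_of_int (Q (Suc n))"
    have c: "c \<ge> 1"
      unfolding c_def by (rule b_ge_1)
    have "ln c \<le> M * (of_int (Q n) + 1)"
      using N[OF \<open>N \<le> n\<close>] by (simp add: c_def)
    also have "\<dots> \<le> M * (real q + 1)"
      using n(1) \<open>M \<ge> 0\<close> by (intro mult_left_mono) auto
    finally have "exp (ln c) \<le> exp (M * (real q + 1))"
      by simp
    then have c_le: "c \<le> exp M * exp M ^ q"
    proof -
      have "exp (M * (real q + 1)) = exp M ^ q * exp M"
        by (simp add: distrib_left exp_add exp_of_nat2_mult)
      then show ?thesis
        using c \<open>exp (ln c) \<le> _\<close> by (simp add: mult.commute[of "exp M"])
    qed
    have "d \<le> 2 * (c * of_int (Q n))"
      using Q_Suc_bounds(2)[of n] unfolding c_def d_def by (simp flip: of_int_mult)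
    also have "\<dots> \<le> 2 * ((exp M * exp M ^ q) * real q)"
      using c_le n(1) Q_pos[of n] c by (intro mult_left_mono mult_mono) auto
    finally have "d * (real q * (real q + 1))
        \<le> 2 * ((exp M * exp M ^ q) * real q) * (real q * (real q + 1))"
      using q by (intro mult_right_mono) auto
    also have "\<dots> = 2 * exp M * (real q ^ 2 * (real q + 1)) * exp M ^ q"
      by (simp add: power2_eq_square)
    also have "\<dots> < r ^ q * exp M ^ q"
      using q by (intro mult_strict_right_mono) auto
    also have "\<dots> = (exp M + \<epsilon>) ^ q"
      by (simp add: r_def power_divide)
    finally have less: "d * (real q * (real q + 1)) < (exp M + \<epsilon>) ^ q" .
    have d: "d \<ge> real q + 1"
      using n(2) unfolding d_def by linarith
    have "1 / (exp M + \<epsilon>) ^ q < 1 / (d * (real q * (real q + 1)))"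
      using less q d \<open>\<epsilon> > 0\<close>
      by (intro divide_strict_left_mono mult_pos_pos zero_less_power add_pos_pos) auto
    also have "\<dots> \<le> (1 / real q - 1 / d) / d"
    proof -
      have "1 / d \<le> 1 / (real q + 1)"
        using d q by (intro divide_left_mono) auto
      moreover have "1 / (real q * (real q + 1)) = 1 / real q - 1 / (real q + 1)"
        using q(3) by (subst diff_frac_eq) auto
      ultimately have "1 / (real q * (real q + 1)) \<le> 1 / real q - 1 / d"
        by simp
      then have "1 / (real q * (real q + 1)) / d \<le> (1 / real q - 1 / d) / d"
        using d q by (intro divide_right_mono) auto
      then show ?thesis
        by (simp add: mult.commute)
    qed
    also have "\<dots> \<le> \<bar>\<alpha> - of_int p / real q\<bar>"
      using fraction_lower[of "int q" n p] n(2) q by (simp add: d_def)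
    finally show ?thesis .
  qed
  moreover have "R > 0"
    using R[of R] by auto
  ultimately show "\<exists>Q>0. \<forall>(p::int) q. q \<ge> Q \<longrightarrow>
      \<bar>\<alpha> - of_int p / of_nat q\<bar> > 1 / (exp M + \<epsilon>) ^ q"
    by blast
qed (use \<open>M \<ge> 0\<close> in auto)

lemma exponent_bound_of_limsup:
  assumes "limsup (\<lambda>n. ereal (ln (of_int (b (n + 1))) / ln (of_nat (fibF n) + B n))) < ereal M"
  shows "exponent_bound \<alpha> (2 + M)"
proof -
  have ge: "of_nat (fibF n) + B n \<ge> 2" for n
    using B_ge_1[of n] fib_neq_0_nat[of "n + 1"] unfolding fibF_def
    by (simp del: fib_neq_0_nat)
  then have pos: "ln (of_nat (fibF n) + B n) > 0" for n
    using ge[of n] by (intro ln_gt_zero) linarith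
  have ev: "\<forall>\<^sub>F n in sequentially. ln (of_int (b (n + 1))) / ln (of_nat (fibF n) + B n) < M"
    using Limsup_lessD[OF assms] by simp
  then obtain n where "ln (of_int (b (n + 1))) / ln (of_nat (fibF n) + B n) < M"
    using eventually_happens'[OF sequentially_bot] by blast
  moreover have "ln (of_int (b (n + 1))) / ln (of_nat (fibF n) + B n) \<ge> 0"
    using pos[of n] b_ge_1[of n] by (intro divide_nonneg_pos) auto
  \<comment> \<open>The quotients are nonnegative and one of them is below \<open>M\<close>. The
    sign is used to enlarge the factor next to \<open>M\<close>.\<close>
  ultimately have "M \<ge> 0"
    by linarith
  show ?thesis
  proof (rule exponent_bound_of_growth[OF \<open>M \<ge> 0\<close>])
    show "\<forall>\<^sub>F n in sequentially. ln (of_int (b (Suc n))) \<le> M * ln (2 * of_int (Q n))"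
      using ev
    proof eventually_elim
      case (elim n)
      have "ln (of_int (b (Suc n))) \<le> M * ln (of_nat (fibF n) + B n)"
        using elim pos[of n] by (simp add: divide_less_eq)
      also have "\<dots> \<le> M * ln (2 * of_int (Q n))"
        using add_le_2Q[of n] ge[of n] \<open>M \<ge> 0\<close> by (intro mult_left_mono ln_mono) auto
      finally show ?case .
    qed
  qed
qed

text \<open>The sharp \<open>Q n + 1\<close> replaces the \<open>2 * Q n\<close> used for the
  exponent, because without a logarithm a factor 2 would change the constant
  \<open>M\<close>.\<close>

lemma base_bound_of_limsup:
  assumes "limsup (\<lambda>n. ereal (ln (of_int (b (n + 1))) / (of_nat (fibF n) + B n))) < ereal M"
  shows "base_bound \<alpha> (exp M)"
proof -
  have pos: "of_nat (fibF n) + B n > 0" for n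
    using B_ge_1[of n] by linarith
  have ev: "\<forall>\<^sub>F n in sequentially. ln (of_int (b (n + 1))) / (of_nat (fibF n) + B n) < M"
    using Limsup_lessD[OF assms] by simp
  then obtain n where "ln (of_int (b (n + 1))) / (of_nat (fibF n) + B n) < M"
    using eventually_happens'[OF sequentially_bot] by blast
  moreover have "ln (of_int (b (n + 1))) / (of_nat (fibF n) + B n) \<ge> 0"
    using pos[of n] b_ge_1[of n] by (intro divide_nonneg_pos) auto
  ultimately have "M \<ge> 0"
    by linarith
  show ?thesis
  proof (rule base_bound_of_growth[OF \<open>M \<ge> 0\<close>])
    show "\<forall>\<^sub>F n in sequentially. ln (of_int (b (Suc n))) \<le> M * (of_int (Q n) + 1)"
      using ev
    proof eventually_elim
      case (elim n)
      have "ln (of_int (b (Suc n))) \<le> M * (of_nat (fibF n) + B n)"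
        using elim pos[of n] by (simp add: divide_less_eq)
      also have "\<dots> \<le> M * (of_int (Q n) + 1)"
        using Q_ge_add[of n] \<open>M \<ge> 0\<close> by (intro mult_left_mono) auto
      finally show ?case .
    qed
  qed
qed

section \<open>The four inequalities in the extended reals\<close>

lemma exponent_Least:
  assumes "exponent_bound \<alpha> \<mu>"
  shows "exponent_bound \<alpha> (LEAST \<mu>. exponent_bound \<alpha> \<mu>)"
    and "(LEAST \<mu>. exponent_bound \<alpha> \<mu>) \<le> \<mu>"
proof -
  \<comment> \<open>With 2 as the lower bound, the infimum is positive, as
    \<open>exponent_bound\<close> demands.\<close>
  have closed: "exponent_bound \<alpha> m"
    if "2 \<le> m" "\<And>e. e > 0 \<Longrightarrow> \<exists>x<m + e. exponent_bound \<alpha> x" for m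
    using that by (intro exponent_bound_closed) auto
  show "exponent_bound \<alpha> (LEAST \<mu>. exponent_bound \<alpha> \<mu>)"
    by (rule Least_real_attained(1)[of "exponent_bound \<alpha>", OF assms exponent_bound_ge_2 closed])
  show "(LEAST \<mu>. exponent_bound \<alpha> \<mu>) \<le> \<mu>"
    by (rule Least_real_attained(2)[of "exponent_bound \<alpha>", OF assms exponent_bound_ge_2 closed assms])
qed

lemma base_Least:
  assumes "base_bound \<alpha> \<beta>"
  shows "base_bound \<alpha> (LEAST \<beta>. base_bound \<alpha> \<beta>)"
    and "(LEAST \<beta>. base_bound \<alpha> \<beta>) \<le> \<beta>"
proof -
  have ge: "x \<ge> 1" if "base_bound \<alpha> x" for x
    using that unfolding base_bound_def by simp
  show "base_bound \<alpha> (LEAST \<beta>. base_bound \<alpha> \<beta>)"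
    by (rule Least_real_attained(1)[of "base_bound \<alpha>", OF assms ge base_bound_closed])
  show "(LEAST \<beta>. base_bound \<alpha> \<beta>) \<le> \<beta>"
    by (rule Least_real_attained(2)[of "base_bound \<alpha>", OF assms ge base_bound_closed assms])
qed

text \<open>If a bound exists, the least one is itself a bound and the limsup estimate applies to
  it; otherwise the right-hand side is infinite.\<close>

lemma exponent_lower:
  "limsup (\<lambda>n. ereal (ln (of_int (b (n + 1))) / ln (of_nat (fibF n) * B n)))
    \<le> irrationality_exponent \<alpha> - 2"
proof (cases "\<exists>\<mu>. exponent_bound \<alpha> \<mu>")
  case True
  then obtain \<mu> where "exponent_bound \<alpha> \<mu>" by blast
  then have "exponent_bound \<alpha> (LEAST \<mu>. exponent_bound \<alpha> \<mu>)"
    by (rule exponent_Least)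
  from limsup_le_of_exponent_bound[OF this] show ?thesis
    using True by (simp add: irrationality_exponent_def flip: ereal_minus(1))
qed (simp add: irrationality_exponent_def)

text \<open>It suffices to treat every \<open>x\<close> strictly above the upper limit: a real
  \<open>x\<close> yields the bound \<open>2 + x\<close>, and \<infinity> is trivial. An infinite
  upper limit leaves no such \<open>x\<close>.\<close>

lemma exponent_upper:
  "irrationality_exponent \<alpha> - 2
    \<le> limsup (\<lambda>n. ereal (ln (of_int (b (n + 1))) / ln (of_nat (fibF n) + B n)))"
proof (rule dense_ge)
  fix x
  assume less: "limsup (\<lambda>n. ereal (ln (of_int (b (n + 1))) / ln (of_nat (fibF n) + B n))) < x"
  show "irrationality_exponent \<alpha> - 2 \<le> x"
  proof (cases x)
    case (real M)
    then have bound: "exponent_bound \<alpha> (2 + M)"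
      using less exponent_bound_of_limsup by simp
    then have "irrationality_exponent \<alpha> = ereal (LEAST \<mu>. exponent_bound \<alpha> \<mu>)"
      by (auto simp: irrationality_exponent_def)
    also have "\<dots> - 2 \<le> x"
      using exponent_Least(2)[OF bound] real
      by simp
    finally show ?thesis .
  qed (use less in auto)
qed

lemma base_lower:
  "limsup (\<lambda>n. ereal (ln (of_int (b (n + 1))) / (of_nat (fibF n) * B n)))
    \<le> ln_ereal (irrationality_base \<alpha>)"
proof (cases "\<exists>\<beta>. base_bound \<alpha> \<beta>")
  case True
  then obtain \<beta> where "base_bound \<alpha> \<beta>" by blast
  then have "base_bound \<alpha> (LEAST \<beta>. base_bound \<alpha> \<beta>)"
    by (rule base_Least)
  from limsup_le_of_base_bound[OF this] show ?thesis
    using True by (simp add: irrationality_base_def ln_ereal_def)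
qed (simp add: irrationality_base_def ln_ereal_def)

lemma base_upper:
  "ln_ereal (irrationality_base \<alpha>)
    \<le> limsup (\<lambda>n. ereal (ln (of_int (b (n + 1))) / (of_nat (fibF n) + B n)))"
proof (rule dense_ge)
  fix x
  assume less: "limsup (\<lambda>n. ereal (ln (of_int (b (n + 1))) / (of_nat (fibF n) + B n))) < x"
  show "ln_ereal (irrationality_base \<alpha>) \<le> x"
  proof (cases x)
    case (real M)
    let ?\<beta> = "LEAST \<beta>. base_bound \<alpha> \<beta>"
    have bound: "base_bound \<alpha> (exp M)"
      using less real base_bound_of_limsup by simp
    \<comment> \<open>Positivity of the minimum is what allows the logarithm to be applied
      monotonically.\<close>
    then have "?\<beta> \<ge> 1"
      using base_Least(1)[OF bound] unfolding base_bound_def by blast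
    then have "ln ?\<beta> \<le> ln (exp M)"
      using base_Least(2)[OF bound] by (intro ln_mono) auto
    then show ?thesis
      using bound real by (auto simp: irrationality_base_def ln_ereal_def)
  qed (use less in auto)
qed

end

theorem corollary2:
  fixes \<alpha> :: real and b :: "nat \<Rightarrow> int"
  assumes "\<alpha> \<notin> \<rat>"
    and "simple_cfrac_expansion \<alpha> b"
  shows "(limsup (\<lambda>n. ereal (ln (of_int (b (n + 1)))
             / ln (of_nat (fibF n) * (\<Prod>k=1..n. of_int (b k)))))
           \<le> irrationality_exponent \<alpha> - 2
       \<and> irrationality_exponent \<alpha> - 2
           \<le> limsup (\<lambda>n. ereal (ln (of_int (b (n + 1)))
             / ln (of_nat (fibF n) + (\<Prod>k=1..n. of_int (b k))))))
     \<and> (limsup (\<lambda>n. ereal (ln (of_int (b (n + 1)))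
             / (of_nat (fibF n) * (\<Prod>k=1..n. of_int (b k)))))
           \<le> ln_ereal (irrationality_base \<alpha>)
       \<and> ln_ereal (irrationality_base \<alpha>)
           \<le> limsup (\<lambda>n. ereal (ln (of_int (b (n + 1)))
             / (of_nat (fibF n) + (\<Prod>k=1..n. of_int (b k))))))"
proof -
  interpret cfrac_expansion \<alpha> b
    by unfold_locales fact
  show ?thesis
    using exponent_lower exponent_upper base_lower base_upper unfolding B_def by blast
qed

end
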